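(* Let $J:\mathbb{R}\to[0,\infty)$ be smooth, radially symmetric (even), with $\int_{\mathbb{R}}J=1$ and supported in the ball of radius $d>0$. If $J>0$ in $(-d,d)$, then the unique solution to $$J*\phi=\phi\ \text{ for }x\ge0,\qquad \phi=0\ \text{ for }-d<x<0,\qquad \phi\in L^\infty(\mathbb{R}_+)$$ is $\phi=0$.
   Context: $\mathbb{R}_+=(0,\infty)$. "Supported in the ball of radius $d$" means $J(z)=0$ for $|z|\ge d$. A solution is a measurable function $\phi:(-d,\infty)\to\mathbb{R}$; for $x\ge0$, $J*\phi(x)=\int J(x-y)\phi(y)\,dy$ only involves values of $\phi$ on $(-d,\infty)$. *)

theory Defs
  imports "HOL-Analysis.Analysis"
begin

definition smooth :: "(real \<Rightarrow> real) \<Rightarrow> bool" where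
  "smooth f \<longleftrightarrow> (\<forall>n x. (deriv ^^ n) f differentiable at x)"

definition kernel :: "real \<Rightarrow> (real \<Rightarrow> real) \<Rightarrow> bool" where
  "kernel d J \<longleftrightarrow>
     smooth J \<and> (\<forall>z. 0 \<le> J z) \<and> (\<forall>z. J (- z) = J z) \<and>
     integral\<^sup>L lebesgue J = 1 \<and> (\<forall>z. \<bar>z\<bar> \<ge> d \<longrightarrow> J z = 0)"

(* Functions on (-d, \<infinity>) are represented by total functions whose values on
   (-\<infinity>, -d] are never inspected. For x \<ge> 0 and J vanishing outside (-d, d), restricting
   the integral to y > -d gives the full convolution, as J (x - y) = 0 for y \<le> -d. *)

definition conv :: "real \<Rightarrow> (real \<Rightarrow> real) \<Rightarrow> (real \<Rightarrow> real) \<Rightarrow> real \<Rightarrow> real" where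
  "conv d J \<phi> x = (LINT y|lebesgue_on {-d<..}. J (x - y) * \<phi> y)"

definition Linfty_on :: "real set \<Rightarrow> (real \<Rightarrow> real) \<Rightarrow> bool" where
  "Linfty_on S f \<longleftrightarrow>
     f \<in> borel_measurable (lebesgue_on S) \<and> (\<exists>C. AE x in lebesgue_on S. \<bar>f x\<bar> \<le> C)"

(* A solution is a function, not a class modulo null sets: the equations hold at every point,
   and only the L^\<infinity> bound is up to null sets. The integrals in conv exist for solutions,
   so the convention that a Bochner integral of a non-integrable function is 0 plays no role. *)

definition solution :: "real \<Rightarrow> (real \<Rightarrow> real) \<Rightarrow> (real \<Rightarrow> real) \<Rightarrow> bool" where
  "solution d J \<phi> \<longleftrightarrow>
     \<phi> \<in> borel_measurable (lebesgue_on {-d<..}) \<and>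
     (\<forall>x\<ge>0. conv d J \<phi> x = \<phi> x) \<and>
     (\<forall>x. -d < x \<and> x < 0 \<longrightarrow> \<phi> x = 0) \<and>
     Linfty_on {0<..} \<phi>"

end

theory Submission
  imports Defs
begin

text \<open>
  The kernel is the law of a symmetric random walk, and the equation says that \<open>\<phi>\<close> is
  a bounded harmonic function for this walk, killed when it leaves the half-line.  Such a function
  vanishes because the walk is recurrent.  The analytic counterpart of recurrence is a positive
  harmonic function that is unbounded at infinity, and here the affine function
  \<open>y \<mapsto> y + d\<close> serves: convolution with an even kernel of mass one reproduces
  affine functions, and this one is positive on \<open>(-d, \<infinity>)\<close>.

  For \<open>\<epsilon> > 0\<close> the harmonic function \<open>w y = \<phi> y - \<epsilon> * (y + d)\<close> is negative on \<open>(-d, 0)\<close> and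
  tends to \<open>-\<infinity>\<close>, so if it is positive somewhere, it attains a positive maximum at a point
  of the closed half-line.  By the mean value property and the positivity of the kernel, \<open>w\<close> equals
  this maximum almost everywhere within distance \<open>d\<close>, in particular somewhere strictly to the left
  of the leftmost maximum point, which is impossible.  Hence \<open>\<phi> x \<le> \<epsilon> * (x + d)\<close> for all
  \<open>\<epsilon> > 0\<close>, so \<open>\<phi> \<le> 0\<close>, and the same applies to \<open>- \<phi>\<close>.

  The maximum exists because a convolution of a bounded function with the kernel is continuous,
  so \<open>\<phi>\<close> is continuous on the closed half-line.
\<close>

section \<open>Convolution with an even kernel\<close>

locale even_kernel =
  fixes J :: "real \<Rightarrow> real" and d :: real
  assumes continuous: "continuous_on UNIV J"
    and nonneg: "0 \<le> J z"
    and even: "J (- z) = J z"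
    and mass_one: "integral\<^sup>L lebesgue J = 1"
    and support: "d \<le> \<bar>z\<bar> \<Longrightarrow> J z = 0"
    and positive: "\<bar>z\<bar> < d \<Longrightarrow> 0 < J z"
    and radius_pos: "0 < d"
begin

lemma bounded_above: obtains K where "\<And>z. J z \<le> K"
proof -
  obtain a where a: "\<And>z. z \<in> {-d..d} \<Longrightarrow> J z \<le> J a"
    using continuous_attains_sup[of "{-d..d}" J] continuous_on_subset[OF continuous] radius_pos
    by (metis atLeastatMost_empty_iff2 compact_Icc less_eq_neg_nonpos nle_le not_le order_less_imp_le top_greatest)
  have "J z \<le> J a" for z
  proof (cases "\<bar>z\<bar> \<le> d")
    case True
    then show ?thesis by (intro a) auto
  next
    case False
    then show ?thesis using support[of z] nonneg[of a] by simp
  qed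
  then show thesis by (rule that)
qed

lemma measurable_shift: "(\<lambda>y. J (x - y)) \<in> borel_measurable lebesgue"
proof -
  have "(\<lambda>y. J (x - y)) \<in> borel_measurable borel"
    by (intro borel_measurable_continuous_onI continuous_on_compose2[OF continuous] continuous_intros) auto
  then show ?thesis by (simp add: measurable_completion)
qed

lemma integrable: "integrable lebesgue J"
  using mass_one not_integrable_integral_eq[of lebesgue J] by fastforce

lemma integrable_shift: "integrable lebesgue (\<lambda>y. J (x - y))"
  using lebesgue_integrable_real_affine[OF integrable, of "-1" x] by simp

lemma integral_shift: "(LINT y|lebesgue. J (x - y)) = 1"
  using lebesgue_integral_real_affine[of "-1" J x] mass_one by simp

lemma integrable_shift_mult:
  assumes "h \<in> borel_measurable lebesgue" "\<And>y. \<bar>h y\<bar> \<le> C"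
  shows "integrable lebesgue (\<lambda>y. J (x - y) * h y)"
proof (rule Bochner_Integration.integrable_bound)
  show "integrable lebesgue (\<lambda>y. C * J (x - y))"
    using integrable_shift by simp
  show "(\<lambda>y. J (x - y) * h y) \<in> borel_measurable lebesgue"
    using measurable_shift assms(1) by (rule borel_measurable_times)
  have "norm (J (x - y) * h y) \<le> norm (C * J (x - y))" for y
    using mult_left_mono[OF order_trans[OF assms(2)[of y] abs_ge_self[of C]] nonneg[of "x - y"]] nonneg[of "x - y"]
    by (simp add: abs_mult mult.commute)
  then show "AE y in lebesgue. norm (J (x - y) * h y) \<le> norm (C * J (x - y))"
    by simp
qed

text \<open>Pointwise in the integration variable the integrand depends continuously on the
  parameter; while the latter stays in a bounded set, the supports stay in a fixed interval,
  which gives a dominating function.\<close>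

lemma continuous_convolution:
  assumes "h \<in> borel_measurable lebesgue" "\<And>y. \<bar>h y\<bar> \<le> C"
  shows "continuous_on S (\<lambda>x. LINT y|lebesgue. J (x - y) * h y)"
proof (rule continuous_on_sequentiallyI)
  fix X :: "nat \<Rightarrow> real" and a assume "X \<longlonglongrightarrow> a"
  then obtain B where B: "\<And>n. \<bar>X n\<bar> \<le> B"
    using convergent_imp_Bseq[of X] by (auto simp: convergent_def Bseq_def)
  obtain K where K: "\<And>z. J z \<le> K" using bounded_above by blast
  show "(\<lambda>n. LINT y|lebesgue. J (X n - y) * h y) \<longlonglongrightarrow> (LINT y|lebesgue. J (a - y) * h y)"
  proof (rule integral_dominated_convergence[where w = "\<lambda>y. (K * C) * indicator {- B - d..B + d} y"])
    show "(\<lambda>y. J (x - y) * h y) \<in> borel_measurable lebesgue" for x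
      using measurable_shift assms(1) by (rule borel_measurable_times)
    then show "(\<lambda>y. J (X n - y) * h y) \<in> borel_measurable lebesgue" for n .
    show "integrable lebesgue (\<lambda>y. (K * C) * indicator {- B - d..B + d} y)"
      by (intro integrable_mult_right integrable_real_indicator) (auto simp: emeasure_lborel_Icc_eq)
    have "(\<lambda>n. J (X n - y)) \<longlonglongrightarrow> J (a - y)" for y
      by (rule continuous_on_tendsto_compose[OF continuous]) (auto intro!: tendsto_intros \<open>X \<longlonglongrightarrow> a\<close>)
    then show "AE y in lebesgue. (\<lambda>n. J (X n - y) * h y) \<longlonglongrightarrow> J (a - y) * h y"
      by (intro always_eventually allI tendsto_mult tendsto_const)
    have "norm (J (X n - y) * h y) \<le> (K * C) * indicator {- B - d..B + d} y" for n y
    proof (cases "y \<in> {- B - d..B + d}")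
      case True
      have "\<bar>J (X n - y)\<bar> * \<bar>h y\<bar> \<le> K * C"
        using K[of "X n - y"] nonneg[of "X n - y"] assms(2)[of y] by (intro mult_mono) auto
      then show ?thesis using True by (simp add: abs_mult)
    next
      case False
      then have "d \<le> \<bar>X n - y\<bar>" using B[of n] by auto
      then show ?thesis using False support[of "X n - y"] by simp
    qed
    then show "AE y in lebesgue. norm (J (X n - y) * h y) \<le> (K * C) * indicator {- B - d..B + d} y" for n
      by simp
  qed
qed

lemma integrable_first_moment: "integrable lebesgue (\<lambda>z. z * J z)"
proof (rule Bochner_Integration.integrable_bound)
  show "integrable lebesgue (\<lambda>z. d * J z)"
    using integrable by simp
  show "(\<lambda>z. z * J z) \<in> borel_measurable lebesgue"
    using integrable by (intro borel_measurable_times) (auto intro: measurable_completion)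
  have "\<bar>z\<bar> * J z \<le> d * J z" for z
    using support[of z] nonneg[of z] by (cases "\<bar>z\<bar> \<le> d") (auto intro: mult_right_mono)
  then show "AE z in lebesgue. norm (z * J z) \<le> norm (d * J z)"
    using nonneg radius_pos by (simp add: abs_mult)
qed

lemma first_moment_zero: "(LINT z|lebesgue. z * J z) = 0"
  using lebesgue_integral_real_affine[of "-1" "\<lambda>z. z * J z" 0] even by simp

text \<open>The substitution \<open>z = x - y\<close> reduces this to the mass and the first moment, which
  vanishes by symmetry.\<close>

lemma affine_mean_value:
  shows "integrable lebesgue (\<lambda>y. J (x - y) * (y + c))"
    and "(LINT y|lebesgue. J (x - y) * (y + c)) = x + c"
proof -
  let ?g = "\<lambda>z. (x + c) * J z - z * J z"
  have g: "integrable lebesgue ?g"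
    using integrable integrable_first_moment by simp
  have eq: "J (x - y) * (y + c) = ?g (x + -1 * y)" for y
    by (simp add: algebra_simps)
  show "integrable lebesgue (\<lambda>y. J (x - y) * (y + c))"
    unfolding eq by (rule lebesgue_integrable_real_affine[OF g]) simp
  have "(LINT y|lebesgue. ?g (x + -1 * y)) = integral\<^sup>L lebesgue ?g"
    using lebesgue_integral_real_affine[of "-1" ?g x] by simp
  also have "\<dots> = x + c"
    using integrable integrable_first_moment mass_one first_moment_zero by simp
  finally show "(LINT y|lebesgue. J (x - y) * (y + c)) = x + c"
    unfolding eq .
qed

section \<open>The maximum principle\<close>

text \<open>A mean over \<open>(x - d, x + d)\<close> with positive weight equals an upper bound of the averaged
  function only if that function is almost everywhere equal to the bound.  Only a point to the left
  is recorded, since the next lemma looks at the leftmost maximum.\<close>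

lemma maximum_propagates_left:
  assumes int: "integrable lebesgue (\<lambda>y. J (x - y) * w y)"
    and mean: "(LINT y|lebesgue. J (x - y) * w y) = M"
    and le: "\<And>y. x - d < y \<Longrightarrow> w y \<le> M"
  obtains y where "x - d < y" "y < x" "w y = M"
proof (rule ccontr)
  assume "\<not> thesis"
  then have no: "\<And>y. x - d < y \<Longrightarrow> y < x \<Longrightarrow> w y \<noteq> M" using that by blast
  let ?g = "\<lambda>y. M * J (x - y) - J (x - y) * w y"
  have g: "integrable lebesgue ?g"
    using int integrable_shift by simp
  have "integral\<^sup>L lebesgue ?g = 0"
    using int integrable_shift integral_shift mean by simp
  moreover have "0 \<le> ?g y" for y
  proof (cases "x - d < y")
    case True
    then show ?thesis
      using mult_left_mono[OF le nonneg, of y "x - y"] by (simp add: mult.commute)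
  next
    case False
    then show ?thesis using support[of "x - y"] by simp
  qed
  ultimately have "AE y in lebesgue. ?g y = 0"
    using integral_nonneg_eq_0_iff_AE[OF g] by simp
  then have "AE y in lebesgue. y \<notin> {x - d<..<x}"
  proof (rule eventually_mono)
    fix y assume "?g y = 0"
    then have "J (x - y) = 0 \<or> w y = M" by auto
    then show "y \<notin> {x - d<..<x}"
      using no[of y] positive[of "x - y"] by auto
  qed
  then have "{x - d<..<x} \<in> null_sets lebesgue"
    by (subst AE_iff_null_sets) auto
  then show False
    using radius_pos by (auto simp: null_sets_def)
qed

text \<open>The one-sided bound is the maximum principle for \<open>u y - e * (y + d)\<close>.  Subtracting the
  line forces the maximum to be attained; without it the supremum of \<open>u\<close> could be approached only
  at infinity.\<close>

lemma bounded_harmonic_nonpos: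
  assumes meas: "u \<in> borel_measurable lebesgue"
    and bound: "\<And>y. \<bar>u y\<bar> \<le> C"
    and left: "\<And>y. y < 0 \<Longrightarrow> u y = 0"
    and mean: "\<And>x. 0 \<le> x \<Longrightarrow> (LINT y|lebesgue. J (x - y) * u y) = u x"
  shows "u x \<le> 0"
proof (rule ccontr)
  assume ux: "\<not> u x \<le> 0"
  then have x: "0 \<le> x" using left[of x] by force
  \<comment> \<open>half of the slope at which \<open>e * (x + d)\<close> equals \<open>u x\<close>\<close>
  define e where "e = u x / (2 * (x + d))"
  define w where "w y = u y - e * (y + d)" for y
  have e: "0 < e" using ux x radius_pos by (simp add: e_def)
  have "w x = u x / 2" using x radius_pos by (simp add: w_def e_def field_simps)
  then have wx: "0 < w x" using ux by simp
  have far: "w y < 0" if "C / e \<le> y" for y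
  proof -
    have "C \<le> e * y" using that e by (simp add: field_simps)
    then show ?thesis
      using bound[of y] mult_pos_pos[OF e radius_pos] by (simp add: w_def algebra_simps)
  qed
  have w_left: "w y < 0" if "- d < y" "y < 0" for y
    using that left[of y] mult_pos_pos[OF e, of "y + d"] by (simp add: w_def)
  have w_int: "integrable lebesgue (\<lambda>y. J (x - y) * w y)"
    and w_mean: "(LINT y|lebesgue. J (x - y) * w y) = w x" if "0 \<le> x" for x
  proof -
    have eq: "J (x - y) * w y = J (x - y) * u y - e * (J (x - y) * (y + d))" for y
      by (simp add: w_def algebra_simps)
    note int = integrable_shift_mult[OF meas bound, of x] affine_mean_value(1)[of x d]
    show "integrable lebesgue (\<lambda>y. J (x - y) * w y)"
      unfolding eq using int by (intro Bochner_Integration.integrable_diff integrable_mult_right)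
    show "(LINT y|lebesgue. J (x - y) * w y) = w x"
      unfolding eq using int mean[OF that] affine_mean_value(2)[of x d]
      by (simp add: w_def)
  qed
  let ?I = "{0..C / e}"
  have "continuous_on ?I u"
    using continuous_convolution[OF meas bound, of ?I] mean by (simp cong: continuous_on_cong_simp)
  then have cont: "continuous_on ?I w"
    unfolding w_def by (intro continuous_intros)
  have xI: "x \<in> ?I" using x wx far[of x] by force
  obtain m where m: "m \<in> ?I" "\<And>y. y \<in> ?I \<Longrightarrow> w y \<le> w m"
    using continuous_attains_sup[OF _ _ cont] xI by auto
  have M: "0 < w m" using wx m(2)[OF xI] by simp
  have le: "w y \<le> w m" if "- d < y" for y
    using m(2)[of y] far[of y] w_left[of y] that M by force
  \<comment> \<open>the leftmost maximum point \<open>p\<close> exists because the set of maximum points is compact\<close>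
  let ?S = "{y \<in> ?I. w y = w m}"
  have "closed ?S"
    using cont by (rule continuous_closed_preimage_constant) simp
  moreover have "bounded ?S"
    by (rule bounded_subset[OF bounded_closed_interval[of 0 "C / e"]]) auto
  ultimately have "compact ?S"
    by (simp add: compact_eq_bounded_closed)
  then obtain p where p: "p \<in> ?S" "\<And>y. y \<in> ?S \<Longrightarrow> p \<le> y"
    using compact_attains_inf[of ?S] m(1) by blast
  then have p0: "0 \<le> p" by simp
  have "w y \<le> w m" if "p - d < y" for y using le that p0 by simp
  moreover have "(LINT y|lebesgue. J (p - y) * w y) = w m" using w_mean[OF p0] p(1) by simp
  ultimately obtain y where y: "p - d < y" "y < p" "w y = w m"
    using maximum_propagates_left[OF w_int[OF p0]] by blast
  then have "0 \<le> y" using w_left[of y] p0 M by force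
  then have "y \<in> ?S" using y p(1) by auto
  then show False using p(2) y(2) by force
qed

lemma bounded_harmonic_zero:
  assumes "u \<in> borel_measurable lebesgue" "\<And>y. \<bar>u y\<bar> \<le> C"
    and "\<And>y. y < 0 \<Longrightarrow> u y = 0"
    and "\<And>x. 0 \<le> x \<Longrightarrow> (LINT y|lebesgue. J (x - y) * u y) = u x"
  shows "u x = 0"
proof (rule antisym)
  show "u x \<le> 0" using assms by (rule bounded_harmonic_nonpos)
  have "- u x \<le> 0"
    by (rule bounded_harmonic_nonpos[where u = "\<lambda>y. - u y"]) (use assms in auto)
  then show "0 \<le> u x" by simp
qed

section \<open>Solutions on the half-line\<close>

text \<open>Passing to the extension by zero allows integrals over the whole line.  The essential
  bound becomes a bound at every point because each value of a solution on the closed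
  half-line is a mean of its values.\<close>

lemma solution_zero:
  assumes sol: "solution d J \<phi>" and x: "- d < x"
  shows "\<phi> x = 0"
proof -
  define u where "u y = (if y \<in> {- d<..} then \<phi> y else 0)" for y
  have meas: "u \<in> borel_measurable lebesgue"
    unfolding u_def using sol by (intro borel_measurable_if_I) (auto simp: solution_def)
  have left: "u y = 0" if "y < 0" for y
    using sol that by (simp add: u_def solution_def)
  have conv: "conv d J \<phi> x = (LINT y|lebesgue. J (x - y) * u y)" for x
    unfolding conv_def
    by (subst integral_restrict_space) (auto simp: u_def indicator_def intro!: Bochner_Integration.integral_cong)
  have mean: "(LINT y|lebesgue. J (x - y) * u y) = u x" if "0 \<le> x" for x
    using sol that radius_pos conv[of x] by (simp add: solution_def u_def)
  obtain C where C: "AE y in lebesgue. 0 < y \<longrightarrow> \<bar>\<phi> y\<bar> \<le> C"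
    using sol by (auto simp: solution_def Linfty_on_def AE_restrict_space_iff)
  have "AE y in lebesgue. y \<noteq> (0::real)"
    by (rule AE_completion) (rule AE_lborel_singleton)
  with C have ae: "AE y in lebesgue. \<bar>u y\<bar> \<le> \<bar>C\<bar>"
  proof eventually_elim
    case (elim y)
    then show ?case using left[of y] by (cases "y < 0") (auto simp: u_def)
  qed
  have bound: "\<bar>u x\<bar> \<le> \<bar>C\<bar>" for x
  proof (cases "x < 0")
    case False
    have dom: "integrable lebesgue (\<lambda>y. \<bar>C\<bar> * J (x - y))" using integrable_shift by simp
    have pointwise: "AE y in lebesgue. norm (J (x - y) * u y) \<le> \<bar>C\<bar> * J (x - y)"
      using ae
    proof eventually_elim
      case (elim y)
      then show ?case
        using mult_left_mono[OF elim nonneg[of "x - y"]] nonneg[of "x - y"]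
        by (simp add: abs_mult mult.commute)
    qed
    have "\<bar>LINT y|lebesgue. J (x - y) * u y\<bar> \<le> (LINT y|lebesgue. \<bar>C\<bar> * J (x - y))"
      using order_trans[OF integral_norm_bound integral_mono_AE'[OF dom pointwise]] nonneg by simp
    also have "\<dots> = \<bar>C\<bar>" using integral_shift by simp
    finally show ?thesis using mean False by simp
  qed (simp add: left)
  have "u x = 0" using meas bound left mean by (rule bounded_harmonic_zero)
  then show ?thesis using x by (simp add: u_def)
qed

end

lemma zero_solution:
  assumes "0 < d" and zero: "\<And>x. - d < x \<Longrightarrow> \<phi> x = 0"
  shows "solution d J \<phi>"
proof -
  have meas: "\<phi> \<in> borel_measurable (lebesgue_on S)" if "S \<subseteq> {- d<..}" for S
  proof -
    have "\<phi> y = 0" if "y \<in> space (lebesgue_on S)" for y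
      using that \<open>S \<subseteq> {- d<..}\<close> zero by (auto simp: space_restrict_space)
    then have "\<phi> \<in> borel_measurable (lebesgue_on S) \<longleftrightarrow>
        (\<lambda>_. 0 :: real) \<in> borel_measurable (lebesgue_on S)"
      by (rule measurable_cong)
    then show ?thesis by simp
  qed
  have "conv d J \<phi> x = (LINT y|lebesgue_on {- d<..}. 0)" for x
    unfolding conv_def by (rule Bochner_Integration.integral_cong) (auto simp: zero)
  moreover have "Linfty_on {0<..} \<phi>"
    unfolding Linfty_on_def
  proof (intro conjI exI)
    show "AE x in lebesgue_on {0<..}. \<bar>\<phi> x\<bar> \<le> 0"
      by (rule AE_I2) (use assms in auto)
  qed (use assms in \<open>auto intro: meas\<close>)
  ultimately show ?thesis
    using assms meas[of "{- d<..}"] by (auto simp: solution_def)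
qed

theorem proposition2p2:
  fixes d :: real and J \<phi> :: "real \<Rightarrow> real"
  assumes "d > 0"
    and "kernel d J"
    and "\<And>z. -d < z \<Longrightarrow> z < d \<Longrightarrow> J z > 0"
  shows "solution d J \<phi> \<longleftrightarrow> (\<forall>x>-d. \<phi> x = 0)"
proof -
  have smooth: "smooth J" using assms(2) by (simp add: kernel_def)
  have "J differentiable at x" for x
    using smooth[unfolded smooth_def, rule_format, of 0] by simp
  then have "continuous_on UNIV J"
    by (intro continuous_at_imp_continuous_on) (auto intro: differentiable_imp_continuous_within)
  then interpret even_kernel J d
    using assms by unfold_locales (auto simp: kernel_def)
  show ?thesis
    using solution_zero zero_solution[OF assms(1)] by blast
qed

end
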